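(* Let $G$ be a connected chordal graph and let $\sigma$ be a legitimate weighting of $G$. Weight each edge of the reduced clique graph $C_R(G)$, joining maximal cliques $C$ and $C'$, by $\sigma(C\cap C')$. Then every clique tree of $G$ is a spanning tree of $C_R(G)$, and every edge of $C_R(G)$ is contained in a clique tree of $G$. Moreover, a spanning tree of $C_R(G)$ is a clique tree of $G$ if and only if it has maximum weight amongst all spanning trees of $C_R(G)$.
   Context: All graphs are finite and simple. A graph is chordal if every cycle with at least four vertices has a chord (an edge joining two vertices of the cycle that is not in the cycle). A clique is a set of pairwise adjacent vertices; maximal cliques are maximal with respect to inclusion. For a set $S$ of vertices, a path is $S$-avoiding if no internal vertex of the path is in $S$. The reduced clique graph $C_R(G)$ of a chordal graph $G$ has the maximal cliques of $G$ as its vertices; distinct maximal cliques $C$ and $C'$ are adjacent in $C_R(G)$ if and only if $C\cap C'\neq\emptyset$ and $C,C'$ form a separating pair, meaning that there is no $(C\cap C')$-avoiding path of $G$ from a vertex in $C-C'$ to a vertex in $C'-C$. A clique tree of $G$ is a tree $T$ whose vertices are the maximal cliques of $G$ such that, for every $v\in V(G)$, the maximal cliques containing $v$ induce a connected subgraph of $T$. (The edges of $T$ are not assumed in advance to be edges of $C_R(G)$.) A legitimate weighting of $G$ is a function $\sigma$ from $\{\emptyset\}\cup\{C\cap C' : C,C' \text{ are distinct maximal cliques of } G\}$ to the non-negative integers such that $\sigma(\emptyset)=0$ and, whenever $X,X'$ are in the domain of $\sigma$ and $X$ is a proper subset of $X'$, $\sigma(X)<\sigma(X')$. The weight of a spanning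 tree is the sum of the weights of its edges. *)

theory Defs
  imports "Graph_Theory.Graph_Theory"
begin

text \<open>
  Graphs are the symmetric, loop-free, finite digraphs \<^locale>\<open>pair_graph\<close> of the entry
  Graph_Theory: an edge is represented by its two opposite arcs. The constants \<open>forest\<close>,
  \<open>tree\<close> and \<open>spanning_tree\<close> of that entry exclude directed cycles only, and already
  the walk along an edge and back counts as one. So they do not express the undirected notions,
  and trees are defined here by the absence of cycles of length at least 3.
\<close>

definition undirected_cycle :: "'a pair_pre_digraph \<Rightarrow> ('a \<times> 'a) awalk \<Rightarrow> bool" where
  "undirected_cycle G p \<longleftrightarrow> pre_digraph.cycle (with_proj G) p \<and> 3 \<le> length p"

definition undirected_tree :: "'a pair_pre_digraph \<Rightarrow> bool" where
  "undirected_tree T \<longleftrightarrow>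
     pair_graph T \<and> Digraph_Component.connected (with_proj T) \<and> (\<nexists>p. undirected_cycle T p)"

definition undirected_spanning_tree :: "'a pair_pre_digraph \<Rightarrow> 'a pair_pre_digraph \<Rightarrow> bool" where
  "undirected_spanning_tree T G \<longleftrightarrow> undirected_tree T \<and> spanning (with_proj T) (with_proj G)"

definition chord :: "'a pair_pre_digraph \<Rightarrow> ('a \<times> 'a) awalk \<Rightarrow> 'a \<Rightarrow> 'a \<Rightarrow> bool" where
  "chord G p u v \<longleftrightarrow>
     u \<in> fst ` set p \<and> v \<in> fst ` set p \<and> (u, v) \<in> parcs G \<and> (u, v) \<notin> set p \<and> (v, u) \<notin> set p"

definition chordal :: "'a pair_pre_digraph \<Rightarrow> bool" where
  "chordal G \<longleftrightarrow> (\<forall>p. undirected_cycle G p \<and> 4 \<le> length p \<longrightarrow> (\<exists>u v. chord G p u v))"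

definition clique :: "'a pair_pre_digraph \<Rightarrow> 'a set \<Rightarrow> bool" where
  "clique G K \<longleftrightarrow> K \<subseteq> pverts G \<and> (\<forall>u\<in>K. \<forall>v\<in>K. u \<noteq> v \<longrightarrow> (u, v) \<in> parcs G)"

definition maximal_cliques :: "'a pair_pre_digraph \<Rightarrow> 'a set set" where
  "maximal_cliques G = {C. clique G C \<and> (\<forall>K. clique G K \<and> C \<subseteq> K \<longrightarrow> K = C)}"

definition avoiding_path ::
  "'a pair_pre_digraph \<Rightarrow> 'a set \<Rightarrow> 'a \<Rightarrow> ('a \<times> 'a) awalk \<Rightarrow> 'a \<Rightarrow> bool" where
  "avoiding_path G S u p v \<longleftrightarrow>
     pre_digraph.apath (with_proj G) u p v \<and>
     set (pre_digraph.inner_verts (with_proj G) p) \<inter> S = {}"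

definition separating_pair :: "'a pair_pre_digraph \<Rightarrow> 'a set \<Rightarrow> 'a set \<Rightarrow> bool" where
  "separating_pair G C C' \<longleftrightarrow>
     \<not> (\<exists>u \<in> C - C'. \<exists>v \<in> C' - C. \<exists>p. avoiding_path G (C \<inter> C') u p v)"

definition reduced_clique_graph :: "'a pair_pre_digraph \<Rightarrow> 'a set pair_pre_digraph" where
  "reduced_clique_graph G =
     \<lparr> pverts = maximal_cliques G,
       parcs = {(C, C'). C \<in> maximal_cliques G \<and> C' \<in> maximal_cliques G \<and> C \<noteq> C' \<and>
                  C \<inter> C' \<noteq> {} \<and> separating_pair G C C'} \<rparr>"

lemma separating_pair_sym:
  assumes "pair_graph G" and "separating_pair G C C'"
  shows "separating_pair G C' C"
proof -
  interpret pair_graph G by fact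
  have rev: "avoiding_path G S v (rev_path p) u" if "avoiding_path G S u p v" for S u p v
  proof -
    have "apath u p v" and "set (inner_verts p) \<inter> S = {}"
      using that by (auto simp: avoiding_path_def)
    moreover from this have "awalk u p v" by (simp add: apath_def)
    ultimately show ?thesis
      by (auto simp: avoiding_path_def apath_def awalk_verts_rev_path inner_verts_rev_path)
  qed
  show ?thesis
    using assms(2) rev unfolding separating_pair_def by (metis inf_commute)
qed

lemma pair_graph_reduced_clique_graph:
  assumes "pair_graph G"
  shows "pair_graph (reduced_clique_graph G)"
proof -
  interpret pair_graph G by fact
  have "maximal_cliques G \<subseteq> Pow (pverts G)"
    by (auto simp: maximal_cliques_def clique_def)
  then have fin: "finite (maximal_cliques G)"
    by (rule finite_subset) (simp add: pair_finite_verts)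
  have "parcs (reduced_clique_graph G) \<subseteq> maximal_cliques G \<times> maximal_cliques G"
    by (auto simp: reduced_clique_graph_def)
  then have "finite (parcs (reduced_clique_graph G))"
    by (rule finite_subset) (simp add: fin)
  then show ?thesis
    using fin separating_pair_sym[OF assms]
    by unfold_locales (auto simp: reduced_clique_graph_def symmetric_def sym_def)
qed

definition clique_tree :: "'a pair_pre_digraph \<Rightarrow> 'a set pair_pre_digraph \<Rightarrow> bool" where
  "clique_tree G T \<longleftrightarrow>
     undirected_tree T \<and> pverts T = maximal_cliques G \<and>
     (\<forall>v \<in> pverts G.
        Digraph_Component.connected (with_proj T \<restriction> {C \<in> maximal_cliques G. v \<in> C}))"

text \<open>
  A weighting is a total function on vertex sets; only its values on the following domain are
  constrained or used.
\<close>

definition weighting_domain :: "'a pair_pre_digraph \<Rightarrow> 'a set set" where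
  "weighting_domain G =
     {{}} \<union> {C \<inter> C' | C C'. C \<in> maximal_cliques G \<and> C' \<in> maximal_cliques G \<and> C \<noteq> C'}"

definition legitimate_weighting :: "'a pair_pre_digraph \<Rightarrow> ('a set \<Rightarrow> nat) \<Rightarrow> bool" where
  "legitimate_weighting G \<sigma> \<longleftrightarrow>
     \<sigma> {} = 0 \<and>
     (\<forall>X \<in> weighting_domain G. \<forall>X' \<in> weighting_domain G. X \<subset> X' \<longrightarrow> \<sigma> X < \<sigma> X')"

text \<open>
  The weight sums over undirected edges, so that the two arcs representing an edge count once;
  for the edge \<open>e = {C, C'}\<close>, \<open>\<Inter>e\<close> is \<open>C \<inter> C'\<close>.
\<close>

definition edges :: "'a pair_pre_digraph \<Rightarrow> 'a set set" where
  "edges G = {{u, v} | u v. (u, v) \<in> parcs G}"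

definition tree_weight :: "('a set \<Rightarrow> nat) \<Rightarrow> 'a set pair_pre_digraph \<Rightarrow> nat" where
  "tree_weight \<sigma> T = (\<Sum>e \<in> edges T. \<sigma> (\<Inter>e))"

end

theory Submission
  imports Defs
begin

text \<open>
  Everything rests on one exchange. Call a tree \<open>T\<close> on the maximal cliques a junction tree if the
  cliques containing any given vertex induce a connected part of it; these are the clique trees.
  If \<open>T\<close> is one and its edge \<open>XY\<close> lies on the path of \<open>T\<close> between \<open>C\<close> and \<open>D\<close>, then a vertex of
  \<open>C \<inter> D\<close> lies in every clique on that path, so \<open>C \<inter> D \<subseteq> X \<inter> Y\<close>
  (\<open>junction_separating_edge\<close>). When the two intersections are equal, replacing \<open>XY\<close> by \<open>CD\<close>
  gives a junction tree again (\<open>junction_swap_edge\<close>).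

  Weights (\<open>junction_tree_max_weight\<close>). Let \<open>T\<close> be a junction tree, \<open>R\<close> any other tree on the
  maximal cliques and \<open>AB\<close> an edge of \<open>R\<close> outside \<open>T\<close>. The path of \<open>T\<close> from \<open>A\<close> to \<open>B\<close> has an
  edge \<open>XY\<close> across the cut that \<open>R - AB\<close> leaves. Then \<open>A \<inter> B \<subseteq> X \<inter> Y\<close>, so \<open>R - AB + XY\<close> is a
  tree at least as heavy as \<open>R\<close> and closer to \<open>T\<close>. By induction \<open>R\<close> weighs at most as much as
  \<open>T\<close>. If the weights agree, then \<open>\<sigma> (A \<inter> B) = \<sigma> (X \<inter> Y)\<close>, hence \<open>A \<inter> B = X \<inter> Y\<close> since \<open>\<sigma>\<close>
  is strictly monotone; by induction \<open>R - AB + XY\<close> is a junction tree, and swapping back shows that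
  \<open>R\<close> is one too.

  Existence (\<open>junction_tree_exists\<close>). A chordal graph has a simplicial vertex (Dirac). Given a
  junction tree of the graph without it, the one maximal clique through that vertex either
  enlarges an old maximal clique or becomes a new leaf.

  The reduced clique graph. Deleting an edge \<open>CD\<close> of a junction tree splits the cliques into two
  sides that share only vertices of \<open>C \<inter> D\<close>, so \<open>C\<close> and \<open>D\<close> form a separating pair; and
  \<open>C \<inter> D\<close> is nonempty because the graph is connected
  (\<open>junction_tree_subset_reduced_clique_graph\<close>). Conversely, if \<open>C\<close> and \<open>D\<close> form a separating
  pair, some edge \<open>XY\<close> on the tree path between them has \<open>X \<inter> Y = C \<inter> D\<close>
  (\<open>separating_pair_tight_edge\<close>): otherwise one could walk from \<open>C - D\<close> to \<open>D - C\<close> along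
  vertices of the successive intersections outside \<open>C \<inter> D\<close>. Swapping \<open>XY\<close> for \<open>CD\<close>
  puts \<open>CD\<close> into a clique tree. As all clique trees are spanning trees of the reduced clique graph,
  the bound on weights yields the last claim.
\<close>

section \<open>Trees as symmetric relations\<close>

abbreviation edge :: "'b \<Rightarrow> 'b \<Rightarrow> ('b \<times> 'b) set" where
  "edge x y \<equiv> {(x, y), (y, x)}"

text \<open>
  Acyclicity in a form that never mentions cycles: no edge lies on a cycle iff removing it
  disconnects its ends. Thereby exchange arguments become statements about reflexive transitive
  closures, and "the edge \<open>xy\<close> lies on the tree path from \<open>a\<close> to \<open>b\<close>" reads
  \<open>(a, b) \<notin> (R - edge x y)\<^sup>*\<close>.
\<close>

definition all_bridges :: "('b \<times> 'b) set \<Rightarrow> bool" where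
  "all_bridges R \<longleftrightarrow> (\<forall>x y. (x, y) \<in> R \<longrightarrow> (x, y) \<notin> (R - edge x y)\<^sup>*)"

definition tree_on :: "'b set \<Rightarrow> ('b \<times> 'b) set \<Rightarrow> bool" where
  "tree_on V R \<longleftrightarrow>
     sym R \<and> R \<subseteq> V \<times> V \<and> (\<forall>x\<in>V. \<forall>y\<in>V. (x, y) \<in> R\<^sup>*) \<and> all_bridges R"

lemma sym_edge [simp]: "sym (edge x y)"
  by (auto simp: sym_def)

lemma sym_Diff_edge: "sym R \<Longrightarrow> sym (R - edge x y)"
  by (auto simp: sym_def)

lemma sym_rtrancl_swap: "sym R \<Longrightarrow> (a, b) \<in> R\<^sup>* \<longleftrightarrow> (b, a) \<in> R\<^sup>*"
  using sym_rtrancl[of R] by (auto simp: sym_def)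

lemma rtrancl_image:
  assumes "(a, b) \<in> R\<^sup>*" and "\<And>x y. (x, y) \<in> R \<Longrightarrow> (f x, f y) \<in> Q"
  shows "(f a, f b) \<in> Q\<^sup>*"
  using assms(1) by induction (auto intro: assms(2) rtrancl.rtrancl_into_rtrancl)

text \<open>
  A path can be cut before its first and after its last use of the edge \<open>xy\<close>. The two outer pieces
  avoid the edge; if they end at the same end of it, they join up to a path of \<open>R\<close>.
\<close>

lemma rtrancl_Un_edge_cases:
  assumes "(a, b) \<in> (R \<union> edge x y)\<^sup>*"
  shows "(a, b) \<in> R\<^sup>* \<or> (a, x) \<in> R\<^sup>* \<and> (y, b) \<in> R\<^sup>* \<or> (a, y) \<in> R\<^sup>* \<and> (x, b) \<in> R\<^sup>*"
  using assms
proof (induction rule: rtrancl_induct)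
  case base
  then show ?case by simp
next
  case (step b c)
  then consider "(b, c) \<in> R" | "b = x" "c = y" | "b = y" "c = x" by auto
  then show ?case
  proof cases
    case 1
    then show ?thesis using step.IH by (meson rtrancl.rtrancl_into_rtrancl)
  qed (use step.IH in auto)
qed

lemma rtrancl_remove_edge_cases:
  assumes "(a, b) \<in> R\<^sup>*"
  obtains "(a, b) \<in> (R - edge x y)\<^sup>*"
  | "(a, x) \<in> (R - edge x y)\<^sup>*" "(y, b) \<in> (R - edge x y)\<^sup>*"
  | "(a, y) \<in> (R - edge x y)\<^sup>*" "(x, b) \<in> (R - edge x y)\<^sup>*"
proof -
  have "(a, b) \<in> ((R - edge x y) \<union> edge x y)\<^sup>*"
    using assms by (rule rtrancl_mono[THEN subsetD, rotated]) blast
  from rtrancl_Un_edge_cases[OF this] show thesis using that by blast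
qed

lemma all_bridges_subset:
  assumes "all_bridges R" and "Q \<subseteq> R"
  shows "all_bridges Q"
  unfolding all_bridges_def
proof (intro allI impI notI)
  fix x y assume "(x, y) \<in> Q" "(x, y) \<in> (Q - edge x y)\<^sup>*"
  moreover have "(Q - edge x y)\<^sup>* \<subseteq> (R - edge x y)\<^sup>*"
    using assms(2) by (intro rtrancl_mono) blast
  ultimately show False using assms by (auto simp: all_bridges_def)
qed

text \<open>
  An old edge \<open>uv\<close> remains a bridge: a detour around it would use \<open>ab\<close>, and the rest of the detour
  together with \<open>uv\<close> would already have joined \<open>a\<close> and \<open>b\<close>.
\<close>

lemma all_bridges_add_edge:
  assumes "sym R" and "all_bridges R" and ab: "(a, b) \<notin> R\<^sup>*"
  shows "all_bridges (R \<union> edge a b)"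
  unfolding all_bridges_def
proof (intro allI impI notI)
  fix u v
  assume uv: "(u, v) \<in> R \<union> edge a b" and r: "(u, v) \<in> (R \<union> edge a b - edge u v)\<^sup>*"
  show False
  proof (cases "(u, v) \<in> edge a b")
    case True
    then have "R \<union> edge a b - edge u v \<subseteq> R" by auto
    then have "(u, v) \<in> R\<^sup>*" using r rtrancl_mono by blast
    then show False using True ab sym_rtrancl_swap[OF assms(1), of u v] by auto
  next
    case False
    then have uvR: "(u, v) \<in> R" using uv by auto
    let ?Q = "R - edge u v"
    have Q: "?Q\<^sup>* \<subseteq> R\<^sup>*" by (intro rtrancl_mono) blast
    have vu: "(v, u) \<in> R" using uvR assms(1) by (simp add: symD)
    have "(u, v) \<in> (?Q \<union> edge a b)\<^sup>*"
      using r by (rule rtrancl_mono[THEN subsetD, rotated]) blast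
    from rtrancl_Un_edge_cases[OF this] show False
    proof (elim disjE conjE)
      assume "(u, v) \<in> ?Q\<^sup>*"
      then show False using assms(2) uvR by (auto simp: all_bridges_def)
    next
      assume "(u, a) \<in> ?Q\<^sup>*" "(b, v) \<in> ?Q\<^sup>*"
      then have "(a, u) \<in> R\<^sup>*" "(v, b) \<in> R\<^sup>*"
        using Q sym_rtrancl_swap[OF assms(1)] by blast+
      then show False using ab uvR by (meson converse_rtrancl_into_rtrancl rtrancl_trans)
    next
      assume "(u, b) \<in> ?Q\<^sup>*" "(a, v) \<in> ?Q\<^sup>*"
      then have "(u, b) \<in> R\<^sup>*" "(a, v) \<in> R\<^sup>*" using Q by blast+
      then show False using ab vu by (meson converse_rtrancl_into_rtrancl rtrancl_trans)
    qed
  qed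
qed

text \<open>
  In a forest the path between two points is unique, so if no single edge of \<open>F\<close> lies on it, then
  \<open>F\<close> can be deleted as a whole. The contrapositive is the way to find an edge of a given kind on a
  tree path. The converse of \<open>F\<close> is deleted as well, since an edge consists of two arcs.
\<close>

lemma rtrancl_remove_edges:
  assumes "sym R" and "all_bridges R" and "finite F" and "F \<subseteq> R"
    and "(a, b) \<in> R\<^sup>*"
    and "\<And>x y. (x, y) \<in> F \<Longrightarrow> (a, b) \<in> (R - edge x y)\<^sup>*"
  shows "(a, b) \<in> (R - (F \<union> F\<inverse>))\<^sup>*"
  using assms(3,4,6)
proof (induction F rule: finite_induct)
  case empty
  then show ?case using assms(5) by simp
next
  case (insert e F)
  obtain x y where e: "e = (x, y)" by (cases e)
  define Q where "Q = R - (F \<union> F\<inverse>)"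
  have Q: "R - (insert e F \<union> (insert e F)\<inverse>) = Q - edge x y"
    by (auto simp: Q_def e)
  have mono: "(Q - edge x y)\<^sup>* \<subseteq> (R - edge x y)\<^sup>*"
    by (intro rtrancl_mono) (auto simp: Q_def)
  have ab: "(a, b) \<in> (R - edge x y)\<^sup>*" using insert.prems(2) e by simp
  have nxy: "(x, y) \<notin> (R - edge x y)\<^sup>*"
    using assms(2) insert.prems(1) e by (auto simp: all_bridges_def)
  note sw = sym_rtrancl_swap[OF sym_Diff_edge[OF assms(1), of x y]]
  have "(a, b) \<in> Q\<^sup>*" using insert by (auto simp: Q_def)
  then have "(a, b) \<in> (Q - edge x y)\<^sup>*"
  proof (cases rule: rtrancl_remove_edge_cases[where x = x and y = y])
    case 2
    then show ?thesis using mono ab nxy sw by (meson rtrancl_trans subsetD)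
  next
    case 3
    then show ?thesis using mono ab nxy sw by (meson rtrancl_trans subsetD)
  qed
  then show ?case by (simp only: Q)
qed

text \<open>
  The hypothesis says that \<open>xy\<close> lies on the tree path from \<open>a\<close> to \<open>b\<close>. So the two parts of
  \<open>R - xy\<close> contain \<open>a\<close> and \<open>b\<close>, respectively, and \<open>ab\<close> joins them again without closing a cycle.
\<close>

lemma tree_swap_edge:
  assumes "tree_on V R" and xy: "(x, y) \<in> R" and "a \<in> V" "b \<in> V"
    and ab: "(a, b) \<notin> (R - edge x y)\<^sup>*"
  shows "tree_on V (R - edge x y \<union> edge a b)"
proof -
  let ?Q = "R - edge x y" and ?N = "R - edge x y \<union> edge a b"
  have R: "sym R" "R \<subseteq> V \<times> V" "all_bridges R" "\<And>x y. x \<in> V \<Longrightarrow> y \<in> V \<Longrightarrow> (x, y) \<in> R\<^sup>*"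
    using assms(1) by (auto simp: tree_on_def)
  have symN: "sym ?N" using sym_Diff_edge[OF R(1)] by (intro sym_Un) auto
  have QN: "?Q\<^sup>* \<subseteq> ?N\<^sup>*" by (intro rtrancl_mono) blast
  note sw = sym_rtrancl_swap[OF sym_Diff_edge[OF R(1), of x y]]
  have abN: "(a, b) \<in> ?N\<^sup>*" "(b, a) \<in> ?N\<^sup>*" by auto
  have xyN: "(x, y) \<in> ?N\<^sup>*"
    using R(4)[OF assms(3,4)]
  proof (cases rule: rtrancl_remove_edge_cases[where x = x and y = y])
    case 1
    then show ?thesis using ab by simp
  next
    case 2
    then have "(x, a) \<in> ?N\<^sup>*" "(b, y) \<in> ?N\<^sup>*" using QN sw by blast+
    then show ?thesis using abN by (meson rtrancl_trans)
  next
    case 3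
    then have "(x, b) \<in> ?N\<^sup>*" "(a, y) \<in> ?N\<^sup>*" using QN sw by blast+
    then show ?thesis using abN by (meson rtrancl_trans)
  qed
  then have "R \<subseteq> ?N\<^sup>*" using sym_rtrancl_swap[OF symN, of x y] by auto
  then have "R\<^sup>* \<subseteq> ?N\<^sup>*" by (rule rtrancl_subset_rtrancl)
  moreover have "all_bridges ?N"
    using all_bridges_add_edge[OF sym_Diff_edge[OF R(1)] all_bridges_subset[OF R(3)] ab] by blast
  ultimately show ?thesis
    using R symN assms(3,4) by (auto simp: tree_on_def)
qed

text \<open>
  The symmetric exchange property of spanning trees: the path of \<open>T\<close> from \<open>a\<close> to \<open>b\<close> must cross
  the cut between the two parts of \<open>T' - ab\<close>, and an edge \<open>xy\<close> of the path that does so can replace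
  \<open>ab\<close> in \<open>T'\<close> and be replaced by it in \<open>T\<close>. The last two conclusions are the conditions for these
  replacements in \<open>tree_swap_edge\<close>.
\<close>

lemma tree_exchange:
  assumes T: "tree_on V T" and T': "tree_on V T'" and "finite T"
    and ab: "(a, b) \<in> T'" "(a, b) \<notin> T"
  obtains x y where "(x, y) \<in> T" "(x, y) \<notin> T'"
    "(a, b) \<notin> (T - edge x y)\<^sup>*" "(x, y) \<notin> (T' - edge a b)\<^sup>*"
proof -
  have s: "sym T" "sym T'" "all_bridges T" "all_bridges T'" using T T' by (auto simp: tree_on_def)
  define Q where "Q = T' - edge a b"
  \<comment> \<open>The side of the cut that contains \<open>a\<close>, and the edges of \<open>T\<close> that leave it.\<close>
  define A where "A = {c. (a, c) \<in> Q\<^sup>*}"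
  define F where "F = {(x, y) \<in> T. x \<in> A \<and> y \<notin> A}"
  have symQ: "sym Q" unfolding Q_def by (rule sym_Diff_edge[OF s(2)])
  have bA: "b \<notin> A" using s(4) ab(1) by (auto simp: A_def Q_def all_bridges_def)
  have abT: "(a, b) \<in> T\<^sup>*" using T T' ab(1) by (auto simp: tree_on_def)
  have "\<exists>x y. (x, y) \<in> F \<and> (a, b) \<notin> (T - edge x y)\<^sup>*"
  proof (rule ccontr)
    assume "\<not> ?thesis"
    then have "(a, b) \<in> (T - (F \<union> F\<inverse>))\<^sup>*"
      using rtrancl_remove_edges[OF s(1,3) _ _ abT, of F] finite_subset[OF _ assms(3), of F]
      by (auto simp: F_def)
    then have "b \<in> A"
    proof (induction rule: rtrancl_induct)
      case base
      then show ?case by (simp add: A_def)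
    next
      case (step c d)
      then show ?case by (auto simp: F_def)
    qed
    then show False using bA by simp
  qed
  then obtain x y where xy: "(x, y) \<in> F" "(a, b) \<notin> (T - edge x y)\<^sup>*" by blast
  have n: "(x, y) \<notin> Q\<^sup>*"
    using xy(1) by (auto simp: F_def A_def dest: rtrancl_trans)
  have "(x, y) \<notin> T'"
  proof
    assume "(x, y) \<in> T'"
    then have "(x, y) \<in> edge a b" using n by (auto simp: Q_def)
    moreover have "(x, y) \<in> T" using xy(1) by (auto simp: F_def)
    ultimately show False using ab(2) s(1) by (auto dest: symD)
  qed
  then show thesis using that xy n by (auto simp: F_def Q_def)
qed

lemma tree_subset_eq:
  assumes "tree_on V T" and "tree_on V T'" and "T' \<subseteq> T"
  shows "T' = T"
proof (rule ccontr)
  assume "T' \<noteq> T"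
  then obtain x y where xy: "(x, y) \<in> T" "(x, y) \<notin> T'" using assms(3) by auto
  have "(y, x) \<notin> T'" using assms(2) xy(2) by (auto simp: tree_on_def dest: symD)
  then have "T'\<^sup>* \<subseteq> (T - edge x y)\<^sup>*" using assms(3) xy(2) by (intro rtrancl_mono) auto
  moreover have "(x, y) \<in> T'\<^sup>*" using assms(1,2) xy(1) by (auto simp: tree_on_def)
  ultimately show False using assms(1) xy(1) by (auto simp: tree_on_def all_bridges_def)
qed

lemma tree_add_leaf:
  assumes "tree_on V R" and "m \<in> V" and "k \<notin> V"
  shows "tree_on (insert k V) (R \<union> edge m k)"
proof -
  have R: "sym R" "R \<subseteq> V \<times> V" "all_bridges R" "\<And>x y. x \<in> V \<Longrightarrow> y \<in> V \<Longrightarrow> (x, y) \<in> R\<^sup>*"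
    using assms(1) by (auto simp: tree_on_def)
  let ?N = "R \<union> edge m k"
  have RN: "R\<^sup>* \<subseteq> ?N\<^sup>*" by (intro rtrancl_mono) blast
  have "(m, k) \<notin> R\<^sup>*"
    using assms(2,3) R(2) by (auto elim: rtranclE)
  then have "all_bridges ?N" using all_bridges_add_edge R by metis
  moreover have symN: "sym ?N" using R(1) by (intro sym_Un) auto
  moreover have mx: "(m, x) \<in> ?N\<^sup>*" if "x \<in> insert k V" for x
    using that R(4)[OF assms(2)] RN by auto
  moreover have "(x, y) \<in> ?N\<^sup>*" if "x \<in> insert k V" "y \<in> insert k V" for x y
    using mx that sym_rtrancl_swap[OF symN] by (meson rtrancl_trans)
  ultimately show ?thesis using R(2) assms(2) by (auto simp: tree_on_def)
qed

lemma tree_image: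
  assumes T: "tree_on V R" and inj: "inj_on f V"
  shows "tree_on (f ` V) (map_prod f f ` R)"
proof -
  have R: "sym R" "R \<subseteq> V \<times> V" "all_bridges R" "\<And>x y. x \<in> V \<Longrightarrow> y \<in> V \<Longrightarrow> (x, y) \<in> R\<^sup>*"
    using T by (auto simp: tree_on_def)
  let ?g = "inv_into V f" and ?N = "map_prod f f ` R"
  have "(f x, f y) \<in> ?N\<^sup>*" if "x \<in> V" "y \<in> V" for x y
    using R(4)[OF that]
    by (rule rtrancl_image) auto
  moreover have "all_bridges ?N"
    unfolding all_bridges_def
  proof (intro allI impI notI)
    fix u v assume uv: "(u, v) \<in> ?N" and r: "(u, v) \<in> (?N - edge u v)\<^sup>*"
    obtain x y where xy: "(x, y) \<in> R" "u = f x" "v = f y" using uv by auto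
    have "(?g u, ?g v) \<in> (R - edge x y)\<^sup>*"
      using r
    proof (rule rtrancl_image)
      fix c d assume "(c, d) \<in> ?N - edge u v"
      then obtain p q where "(p, q) \<in> R" "c = f p" "d = f q" "(c, d) \<notin> edge u v" by auto
      then show "(?g c, ?g d) \<in> R - edge x y" using xy R(2) inj by (auto simp: inv_into_f_f)
    qed
    moreover have "x \<in> V" "y \<in> V" using xy R(2) by auto
    ultimately show False using R(3) xy inj by (auto simp: all_bridges_def inv_into_f_f)
  qed
  moreover have "sym ?N" using R(1) by (force simp: sym_def)
  ultimately show ?thesis using R(2) by (auto simp: tree_on_def)
qed

section \<open>Junction trees and weights\<close>

text \<open>
  The defining property of clique trees, known as the junction (or running intersection) property.
  It ranges over all \<open>v\<close>, as it is vacuous for a \<open>v\<close> outside every member of \<open>\<K>\<close>.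
\<close>

definition junction :: "'a set set \<Rightarrow> ('a set \<times> 'a set) set \<Rightarrow> bool" where
  "junction \<K> R \<longleftrightarrow>
     (\<forall>v. \<forall>C\<in>\<K>. \<forall>D\<in>\<K>. v \<in> C \<inter> D \<longrightarrow> (C, D) \<in> (R \<inter> {X. v \<in> X} \<times> {X. v \<in> X})\<^sup>*)"

definition weight :: "('a set \<Rightarrow> nat) \<Rightarrow> ('a set \<times> 'a set) set \<Rightarrow> nat" where
  "weight \<sigma> R = (\<Sum>e \<in> {{X, Y} | X Y. (X, Y) \<in> R}. \<sigma> (\<Inter>e))"

lemma sym_Restr: "sym R \<Longrightarrow> sym (R \<inter> S \<times> S)"
  by (auto simp: sym_def)

text \<open>
  A vertex of \<open>C \<inter> D\<close> outside \<open>X \<inter> Y\<close> would provide a connection between \<open>C\<close> and \<open>D\<close> that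
  avoids the edge \<open>XY\<close>.
\<close>

lemma junction_separating_edge:
  assumes "junction \<K> R" and "C \<in> \<K>" "D \<in> \<K>" and CD: "(C, D) \<notin> (R - edge X Y)\<^sup>*"
  shows "C \<inter> D \<subseteq> X \<inter> Y"
proof (rule ccontr)
  assume "\<not> ?thesis"
  then obtain v where v: "v \<in> C \<inter> D" "v \<notin> X \<inter> Y" by blast
  then have "(C, D) \<in> (R \<inter> {X. v \<in> X} \<times> {X. v \<in> X})\<^sup>*"
    using assms(1-3) by (auto simp: junction_def)
  moreover have "(R \<inter> {X. v \<in> X} \<times> {X. v \<in> X})\<^sup>* \<subseteq> (R - edge X Y)\<^sup>*"
    using v(2) by (intro rtrancl_mono) auto
  ultimately show False using CD by blast
qed

text \<open>
  Only the vertices \<open>v\<close> of \<open>X \<inter> Y = C \<inter> D\<close> notice the deletion of \<open>XY\<close>. For these, \<open>XY\<close> lay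
  between \<open>C\<close> and \<open>D\<close>, so the new edge \<open>CD\<close> rejoins the two parts of the subtree of \<open>v\<close>.
\<close>

lemma junction_swap_edge:
  assumes "sym R" and J: "junction \<K> R" and "C \<in> \<K>" "D \<in> \<K>"
    and CD: "(C, D) \<notin> (R - edge X Y)\<^sup>*" and eq: "X \<inter> Y = C \<inter> D"
  shows "junction \<K> (R - edge X Y \<union> edge C D)"
  unfolding junction_def
proof (intro allI ballI impI)
  fix v A B assume AB: "A \<in> \<K>" "B \<in> \<K>" "v \<in> A \<inter> B"
  let ?V = "{X. v \<in> X}"
  define P where "P = R \<inter> ?V \<times> ?V"
  define N where "N = (R - edge X Y \<union> edge C D) \<inter> ?V \<times> ?V"
  have AB_P: "(A, B) \<in> P\<^sup>*" using J AB by (auto simp: junction_def P_def)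
  have "P \<subseteq> N\<^sup>*"
  proof (cases "v \<in> C \<inter> D")
    case False
    then have "P \<subseteq> N" using eq by (auto simp: P_def N_def)
    then show ?thesis by auto
  next
    case True
    have symN: "sym N"
      unfolding N_def by (intro sym_Restr sym_Un sym_Diff_edge assms(1) sym_edge)
    note sw = sym_rtrancl_swap[OF symN]
    have PN: "(P - edge X Y)\<^sup>* \<subseteq> N\<^sup>*" by (intro rtrancl_mono) (auto simp: P_def N_def)
    have CDN: "(C, D) \<in> N\<^sup>*" using True by (auto simp: N_def)
    have "(C, D) \<in> P\<^sup>*" using J assms(3,4) True by (auto simp: junction_def P_def)
    then have "(X, Y) \<in> N\<^sup>*"
    proof (cases rule: rtrancl_remove_edge_cases[where x = X and y = Y])
      case 1
      moreover have "(P - edge X Y)\<^sup>* \<subseteq> (R - edge X Y)\<^sup>*"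
        by (intro rtrancl_mono) (auto simp: P_def)
      ultimately show ?thesis using CD by blast
    next
      case 2
      then have "(X, C) \<in> N\<^sup>*" "(D, Y) \<in> N\<^sup>*" using PN sw by blast+
      then show ?thesis using CDN by (meson rtrancl_trans)
    next
      case 3
      then have "(X, D) \<in> N\<^sup>*" "(C, Y) \<in> N\<^sup>*" using PN sw by blast+
      then show ?thesis using CDN sw by (meson rtrancl_trans)
    qed
    then have "edge X Y \<subseteq> N\<^sup>*" using sw by blast
    moreover have "P - edge X Y \<subseteq> N\<^sup>*" using PN by blast
    ultimately show ?thesis by blast
  qed
  then have "P\<^sup>* \<subseteq> N\<^sup>*" by (rule rtrancl_subset_rtrancl)
  then show "(A, B) \<in> ((R - edge X Y \<union> edge C D) \<inter> ?V \<times> ?V)\<^sup>*"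
    using AB_P by (auto simp: N_def)
qed

lemma weight_swap_edge:
  assumes "finite R" and "sym R" and xy: "(X, Y) \<in> R" and ab: "(A, B) \<notin> R - edge X Y"
  shows "weight \<sigma> (R - edge X Y \<union> edge A B) + \<sigma> (X \<inter> Y) = weight \<sigma> R + \<sigma> (A \<inter> B)"
proof -
  define F where "F = {{U, V} | U V. (U, V) \<in> R - edge X Y}"
  have fin: "finite F"
    by (rule finite_subset[of _ "(\<lambda>(U, V). {U, V}) ` R"]) (auto simp: F_def assms(1))
  have s: "(B, A) \<notin> R - edge X Y" using ab assms(2) by (auto dest: symD)
  have "{X, Y} \<notin> F" by (auto simp: F_def doubleton_eq_iff)
  moreover have "{A, B} \<notin> F" using ab s by (auto simp: F_def doubleton_eq_iff)
  moreover have "{{U, V} | U V. (U, V) \<in> R} = insert {X, Y} F"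
    using xy by (auto simp: F_def doubleton_eq_iff)
  moreover have "{{U, V} | U V. (U, V) \<in> R - edge X Y \<union> edge A B} = insert {A, B} F"
    by (auto simp: F_def doubleton_eq_iff)
  ultimately show ?thesis using fin by (simp add: weight_def)
qed

text \<open>
  Induction on the number of edges of \<open>R\<close> outside \<open>T\<close>, exchanging one of them for an edge of \<open>T\<close>
  that is at least as heavy. The case of equality belongs to the same induction: strict
  monotonicity turns equal weights into equal intersections, so that the junction property passes
  back from the exchanged tree to \<open>R\<close>.
\<close>

lemma junction_tree_max_weight:
  assumes fin: "finite \<K>"
    and mono: "\<And>A B C D. A \<in> \<K> \<Longrightarrow> B \<in> \<K> \<Longrightarrow> C \<in> \<K> \<Longrightarrow> D \<in> \<K> \<Longrightarrow> A \<noteq> B \<Longrightarrow> C \<noteq> D \<Longrightarrow>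
      A \<inter> B \<subset> C \<inter> D \<Longrightarrow> \<sigma> (A \<inter> B) < (\<sigma> (C \<inter> D) :: nat)"
    and T: "tree_on \<K> T" "junction \<K> T"
    and "tree_on \<K> R"
  shows "weight \<sigma> R \<le> weight \<sigma> T \<and> (weight \<sigma> R = weight \<sigma> T \<longrightarrow> junction \<K> R)"
  using assms(5)
proof (induction "card (R - T)" arbitrary: R rule: less_induct)
  case less
  have fT: "finite T" "finite R"
    using T(1) less.prems fin by (auto simp: tree_on_def intro: finite_subset[OF _ finite_cartesian_product])
  show ?case
  proof (cases "R \<subseteq> T")
    case True
    then show ?thesis using tree_subset_eq[OF T(1) less.prems] T(2) by simp
  next
    case False
    then obtain A B where AB: "(A, B) \<in> R" "(A, B) \<notin> T" by auto
    obtain X Y where XY: "(X, Y) \<in> T" "(X, Y) \<notin> R"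
      and sepT: "(A, B) \<notin> (T - edge X Y)\<^sup>*" and sepR: "(X, Y) \<notin> (R - edge A B)\<^sup>*"
      using tree_exchange[OF T(1) less.prems fT(1) AB] by metis
    have mem: "A \<in> \<K>" "B \<in> \<K>" "X \<in> \<K>" "Y \<in> \<K>"
      using AB(1) XY(1) T(1) less.prems by (auto simp: tree_on_def)
    have symR: "sym R" "sym T" using less.prems T(1) by (auto simp: tree_on_def)
    have ne: "A \<noteq> B" "X \<noteq> Y" using sepT sepR by auto
    have sub: "A \<inter> B \<subseteq> X \<inter> Y"
      using junction_separating_edge[OF T(2) mem(1,2) sepT] .
    have le: "\<sigma> (A \<inter> B) \<le> \<sigma> (X \<inter> Y)"
      using mono[OF mem ne] sub by (metis less_imp_le order_refl psubsetI)
    define Q where "Q = R - edge A B \<union> edge X Y"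
    have treeQ: "tree_on \<K> Q"
      unfolding Q_def using tree_swap_edge[OF less.prems AB(1) mem(3,4) sepR] .
    have w: "weight \<sigma> Q + \<sigma> (A \<inter> B) = weight \<sigma> R + \<sigma> (X \<inter> Y)"
      unfolding Q_def using weight_swap_edge[OF fT(2) symR(1) AB(1)] XY(2) by blast
    have "(Y, X) \<in> T" using XY(1) symR(2) by (auto dest: symD)
    then have "Q - T \<subset> R - T" using AB XY(1) unfolding Q_def by blast
    then have "card (Q - T) < card (R - T)" using fT by (intro psubset_card_mono) auto
    then have IH: "weight \<sigma> Q \<le> weight \<sigma> T" "weight \<sigma> Q = weight \<sigma> T \<Longrightarrow> junction \<K> Q"
      using less.hyps treeQ by blast+
    have "junction \<K> R" if "weight \<sigma> R = weight \<sigma> T"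
    proof -
      have eq: "weight \<sigma> Q = weight \<sigma> T" "\<sigma> (A \<inter> B) = \<sigma> (X \<inter> Y)" using that IH(1) w le by auto
      then have XY_AB: "X \<inter> Y = A \<inter> B" using mono[OF mem ne] sub by (metis less_irrefl psubsetI)
      have YX: "(Y, X) \<notin> R" "(B, A) \<in> R" using XY(2) AB(1) symR(1) by (auto dest: symD)
      have Q1: "Q - edge X Y = R - edge A B" using XY(2) YX by (auto simp: Q_def)
      have Q2: "Q - edge X Y \<union> edge A B = R" unfolding Q1 using AB(1) YX by auto
      have "(A, B) \<notin> (R - edge A B)\<^sup>*"
        using less.prems AB(1) by (auto simp: tree_on_def all_bridges_def)
      then have "(A, B) \<notin> (Q - edge X Y)\<^sup>*" by (simp only: Q1 not_False_eq_True)
      from junction_swap_edge[OF _ IH(2)[OF eq(1)] mem(1,2) this XY_AB] treeQ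
      show ?thesis unfolding Q2 by (auto simp: tree_on_def)
    qed
    then show ?thesis using IH(1) w le by auto
  qed
qed

section \<open>Existence of junction trees\<close>

text \<open>
  Chordality in the form in which Dirac's argument uses it: two neighbours of \<open>x\<close> that are connected
  via non-neighbours of \<open>x\<close> are adjacent. As \<open>B\<close> is an arbitrary set, the condition covers all
  induced subgraphs at once.
\<close>

definition no_hole :: "('a \<times> 'a) set \<Rightarrow> bool" where
  "no_hole E \<longleftrightarrow>
     (\<forall>x s t B. (x, s) \<in> E \<longrightarrow> (x, t) \<in> E \<longrightarrow> s \<noteq> t \<longrightarrow> (\<forall>b\<in>B. b \<noteq> x \<and> (x, b) \<notin> E) \<longrightarrow>
        (s, t) \<in> (E \<inter> (B \<union> {s, t}) \<times> (B \<union> {s, t}))\<^sup>* \<longrightarrow> (s, t) \<in> E)"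

definition simplicial :: "('a \<times> 'a) set \<Rightarrow> 'a set \<Rightarrow> 'a \<Rightarrow> bool" where
  "simplicial E W z \<longleftrightarrow> (\<forall>u\<in>W. \<forall>v\<in>W. (z, u) \<in> E \<longrightarrow> (z, v) \<in> E \<longrightarrow> u \<noteq> v \<longrightarrow> (u, v) \<in> E)"

text \<open>
  Dirac's theorem, in the strengthened form that carries the induction. Let \<open>B\<close> be a component of
  the non-neighbours of \<open>x\<close> and \<open>S\<close> its neighbourhood, which is a clique as there are no holes.
  A vertex of \<open>B\<close> that is simplicial in \<open>B \<union> S\<close> is simplicial in \<open>W\<close>, because \<open>B \<union> S\<close> contains all
  its neighbours. Such a vertex comes from the induction hypothesis for \<open>B \<union> S\<close>, applied to a
  vertex of \<open>S\<close> with a non-neighbour if there is one and to such a vertex of \<open>B\<close> otherwise; in both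
  cases the simplicial vertex obtained cannot lie in \<open>S\<close>. If \<open>B \<union> S\<close> is complete, any vertex of \<open>B\<close>
  will do.
\<close>

lemma simplicial_nonadjacent:
  assumes "sym E" and "no_hole E" and "finite W"
    and "x \<in> W" "y \<in> W" "y \<noteq> x" "(x, y) \<notin> E"
  shows "\<exists>z\<in>W. z \<noteq> x \<and> (x, z) \<notin> E \<and> simplicial E W z"
  using assms(3-)
proof (induction W arbitrary: x y rule: finite_psubset_induct)
  case (psubset W)
  have symE: "(u, v) \<in> E \<longleftrightarrow> (v, u) \<in> E" for u v using assms(1) by (auto dest: symD)
  define M where "M = {u \<in> W. u \<noteq> x \<and> (x, u) \<notin> E}"
  define B where "B = {b. (y, b) \<in> (E \<inter> M \<times> M)\<^sup>*}"
  define S where "S = {s \<in> W. (x, s) \<in> E \<and> (\<exists>b\<in>B. (b, s) \<in> E)}"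
  have yM: "y \<in> M" using psubset.prems by (auto simp: M_def)
  have yB: "y \<in> B" by (auto simp: B_def)
  have BM: "B \<subseteq> M"
  proof
    fix b assume "b \<in> B"
    then have "(y, b) \<in> (E \<inter> M \<times> M)\<^sup>*" by (simp add: B_def)
    then show "b \<in> M" using yM by cases auto
  qed
  \<comment> \<open>A neighbour of \<open>B\<close> outside \<open>B\<close> is adjacent to \<open>x\<close>, because \<open>B\<close> is a component of \<open>M\<close>.\<close>
  have closed: "u \<in> B \<union> S" if "b \<in> B" "u \<in> W" "(b, u) \<in> E" for b u
  proof (cases "(x, u) \<in> E")
    case True
    then show ?thesis using that by (auto simp: S_def)
  next
    case False
    have "b \<in> M" using BM that(1) by blast
    moreover from this have "u \<noteq> x" using that(3) symE by (auto simp: M_def)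
    ultimately have "(b, u) \<in> E \<inter> M \<times> M" using that False by (auto simp: M_def)
    then show ?thesis using that(1) by (auto simp: B_def intro: rtrancl.rtrancl_into_rtrancl)
  qed
  have yB_path: "(y, b) \<in> (E \<inter> B \<times> B)\<^sup>*" if "b \<in> B" for b
  proof -
    have "(y, b) \<in> (E \<inter> M \<times> M)\<^sup>*" using that by (simp add: B_def)
    then show ?thesis
    proof (induction rule: rtrancl_induct)
      case base
      then show ?case by simp
    next
      case (step c d)
      then have "c \<in> B" "d \<in> B" by (auto simp: B_def intro: rtrancl.rtrancl_into_rtrancl)
      then show ?case using step by (auto intro: rtrancl.rtrancl_into_rtrancl)
    qed
  qed
  have S_clique: "(s, t) \<in> E" if "s \<in> S" "t \<in> S" "s \<noteq> t" for s t
  proof -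
    let ?P = "E \<inter> (B \<union> {s, t}) \<times> (B \<union> {s, t})"
    from that obtain b c where bc: "b \<in> B" "(b, s) \<in> E" "c \<in> B" "(c, t) \<in> E"
      unfolding S_def by blast
    have "(E \<inter> B \<times> B)\<^sup>* \<subseteq> ?P\<^sup>*" by (intro rtrancl_mono) auto
    then have "(y, b) \<in> ?P\<^sup>*" "(y, c) \<in> ?P\<^sup>*" using yB_path bc by blast+
    moreover have symP: "sym ?P" by (rule sym_Restr[OF assms(1)])
    ultimately have "(b, c) \<in> ?P\<^sup>*" using sym_rtrancl_swap[OF symP] by (meson rtrancl_trans)
    moreover have "(s, b) \<in> ?P" "(c, t) \<in> ?P" using bc symE by auto
    ultimately have "(s, t) \<in> ?P\<^sup>*"
      by (meson converse_rtrancl_into_rtrancl rtrancl.rtrancl_into_rtrancl)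
    moreover have "\<forall>b\<in>B. b \<noteq> x \<and> (x, b) \<notin> E" using BM by (auto simp: M_def)
    moreover have "(x, s) \<in> E" "(x, t) \<in> E" using that by (auto simp: S_def)
    ultimately show ?thesis using assms(2) that(3) unfolding no_hole_def by blast
  qed
  define H where "H = B \<union> S"
  have xS: "x \<notin> S"
  proof
    assume "x \<in> S"
    then obtain b where "b \<in> B" "(b, x) \<in> E" by (auto simp: S_def)
    then show False using BM symE by (auto simp: M_def)
  qed
  have "H \<subseteq> W" "x \<notin> H" using BM xS by (auto simp: H_def M_def S_def)
  then have HW: "H \<subset> W" using psubset.prems(1) by blast
  have key: ?case if "z \<in> B" "simplicial E H z" for z
  proof -
    have "simplicial E W z"
      using that closed[OF that(1)] unfolding simplicial_def H_def by blast
    then show ?thesis using that(1) BM by (auto simp: M_def)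
  qed
  consider (S) s h where "s \<in> S" "h \<in> H" "h \<noteq> s" "(s, h) \<notin> E"
    | (B) b h where "b \<in> B" "h \<in> H" "h \<noteq> b" "(b, h) \<notin> E"
        "\<And>s h. s \<in> S \<Longrightarrow> h \<in> H \<Longrightarrow> h \<noteq> s \<Longrightarrow> (s, h) \<in> E"
    | (complete) "\<And>u v. u \<in> H \<Longrightarrow> v \<in> H \<Longrightarrow> u \<noteq> v \<Longrightarrow> (u, v) \<in> E"
    unfolding H_def by blast
  then show ?case
  proof cases
    case S
    then obtain z where z: "z \<in> H" "z \<noteq> s" "(s, z) \<notin> E" "simplicial E H z"
      using psubset.IH[OF HW _ S(2-4)] by (auto simp: H_def)
    then have "z \<notin> S" using S_clique S(1) by blast
    then show ?thesis using key z by (auto simp: H_def)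
  next
    case B
    then obtain z where z: "z \<in> H" "z \<noteq> b" "(b, z) \<notin> E" "simplicial E H z"
      using psubset.IH[OF HW _ B(2-4)] by (auto simp: H_def)
    then have "z \<notin> S" using B(5)[of z b] B(1) symE[of b z] by (auto simp: H_def)
    then show ?thesis using key z by (auto simp: H_def)
  next
    case complete
    then show ?thesis using key[OF yB] by (auto simp: simplicial_def)
  qed
qed

lemma simplicial_exists:
  assumes "sym E" and "no_hole E" and "finite W" and "W \<noteq> {}"
  obtains z where "z \<in> W" "simplicial E W z"
proof (cases "\<exists>x\<in>W. \<exists>y\<in>W. y \<noteq> x \<and> (x, y) \<notin> E")
  case True
  then show thesis using simplicial_nonadjacent[OF assms(1-3)] that by blast
next
  case False
  then have complete: "(u, v) \<in> E" if "u \<in> W" "v \<in> W" "u \<noteq> v" for u v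
    using that by metis
  obtain z where "z \<in> W" using assms(4) by blast
  moreover have "simplicial E W z" unfolding simplicial_def by (auto intro: complete)
  ultimately show thesis by (rule that)
qed

text \<open>
  The graph \<open>G\<lparr>pverts := W\<rparr>\<close> stands for the subgraph induced by \<open>W\<close>. It may keep arcs that leave
  \<open>W\<close>; the notion of clique ignores these.
\<close>

lemma clique_update: "clique (G\<lparr>pverts := W\<rparr>) K \<longleftrightarrow> K \<subseteq> W \<and> (\<forall>u\<in>K. \<forall>v\<in>K. u \<noteq> v \<longrightarrow> (u, v) \<in> parcs G)"
  by (simp add: clique_def)

lemma clique_in_maximal_clique:
  assumes "finite (pverts G)" and "clique G K"
  obtains C where "C \<in> maximal_cliques G" "K \<subseteq> C"
proof -
  let ?A = "{C. clique G C}"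
  have "finite ?A"
    by (rule finite_subset[of _ "Pow (pverts G)"]) (auto simp: clique_def assms(1))
  then obtain C where "C \<in> ?A" "K \<subseteq> C" "\<forall>D\<in>?A. C \<subseteq> D \<longrightarrow> D = C"
    using finite_has_maximal2[of ?A K] assms(2) by auto
  then show thesis using that[of C] by (auto simp: maximal_cliques_def)
qed

text \<open>
  The closed neighbourhood of \<open>z\<close> is the only maximal clique through \<open>z\<close>. Of the old maximal cliques,
  only \<open>N\<close> itself, if it is one, stops being maximal.
\<close>

lemma maximal_cliques_remove_simplicial:
  assumes "sym (parcs G)" and z: "z \<in> W" "simplicial (parcs G) W z" "(z, z) \<notin> parcs G"
  defines "N \<equiv> {u \<in> W. (z, u) \<in> parcs G}"
  shows "maximal_cliques (G\<lparr>pverts := W\<rparr>)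
       = insert (insert z N) (maximal_cliques (G\<lparr>pverts := W - {z}\<rparr>) - {N})"
    (is "?M = insert ?K (?M' - {N})")
proof -
  have symE: "(u, v) \<in> parcs G \<longleftrightarrow> (v, u) \<in> parcs G" for u v using assms(1) by (auto dest: symD)
  let ?G = "G\<lparr>pverts := W\<rparr>" and ?G' = "G\<lparr>pverts := W - {z}\<rparr>"
  have K: "clique ?G ?K"
    using z symE unfolding clique_update N_def simplicial_def by blast
  have N: "clique ?G' N" "z \<notin> N"
    using z K unfolding clique_update N_def by blast+
  have sub: "C \<subseteq> ?K" if "clique ?G C" "z \<in> C" for C
    using that by (auto simp: clique_update N_def)
  have restr: "clique ?G' C \<longleftrightarrow> clique ?G C \<and> z \<notin> C" for C
    unfolding clique_update by blast
  have "?K \<in> ?M" unfolding maximal_cliques_def using K sub by blast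
  moreover have "C = ?K \<or> C \<in> ?M' - {N}" if "C \<in> ?M" for C
  proof (cases "z \<in> C")
    case True
    then show ?thesis using that K sub unfolding maximal_cliques_def by blast
  next
    case False
    moreover from this have "C \<in> ?M'"
      using that unfolding maximal_cliques_def restr by blast
    moreover have "C \<noteq> N"
      using that K N(2) unfolding maximal_cliques_def by blast
    ultimately show ?thesis by blast
  qed
  moreover have "C \<in> ?M" if C: "C \<in> ?M'" "C \<noteq> N" for C
  proof -
    have c: "clique ?G C" "z \<notin> C" using C(1) restr by (auto simp: maximal_cliques_def)
    have "D = C" if D: "clique ?G D" "C \<subseteq> D" for D
    proof (cases "z \<in> D")
      case True
      then have "C \<subseteq> N" using sub D c(2) by blast
      then show ?thesis using C N(1) by (auto simp: maximal_cliques_def)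
    next
      case False
      then show ?thesis using C(1) D restr by (auto simp: maximal_cliques_def)
    qed
    then show ?thesis using c by (auto simp: maximal_cliques_def)
  qed
  ultimately show ?thesis by blast
qed

text \<open>
  Induction by removing a simplicial vertex \<open>z\<close> with neighbourhood \<open>N\<close>. If \<open>N\<close> was a maximal clique,
  it is renamed to \<open>insert z N\<close> in the old tree; otherwise \<open>insert z N\<close> is attached as a leaf
  to a maximal clique containing \<open>N\<close>. The induction starts from the empty vertex set, whose
  single maximal clique is the empty set.
\<close>

lemma junction_tree_exists:
  assumes "sym (parcs G)" and "irrefl (parcs G)" and "no_hole (parcs G)" and "finite W"
  shows "\<exists>R. tree_on (maximal_cliques (G\<lparr>pverts := W\<rparr>)) R \<and>
             junction (maximal_cliques (G\<lparr>pverts := W\<rparr>)) R"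
  using assms(4)
proof (induction W rule: finite_psubset_induct)
  case (psubset W)
  show ?case
  proof (cases "W = {}")
    case True
    have "maximal_cliques (G\<lparr>pverts := {}\<rparr>) = {{}}"
      by (auto simp: maximal_cliques_def clique_def)
    then have "tree_on (maximal_cliques (G\<lparr>pverts := W\<rparr>)) {} \<and>
               junction (maximal_cliques (G\<lparr>pverts := W\<rparr>)) {}"
      using True by (auto simp: tree_on_def junction_def all_bridges_def sym_def)
    then show ?thesis by blast
  next
    case False
    then obtain z where z: "z \<in> W" "simplicial (parcs G) W z"
      using simplicial_exists[OF assms(1,3) psubset.hyps] by blast
    define N where "N = {u \<in> W. (z, u) \<in> parcs G}"
    define \<K> where "\<K> = maximal_cliques (G\<lparr>pverts := W - {z}\<rparr>)"
    let ?K = "insert z N"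
    have zz: "(z, z) \<notin> parcs G" using assms(2) by (auto simp: irrefl_def)
    have eq: "maximal_cliques (G\<lparr>pverts := W\<rparr>) = insert ?K (\<K> - {N})"
      using maximal_cliques_remove_simplicial[OF assms(1) z zz] by (simp add: N_def \<K>_def)
    have zK: "z \<notin> X" if "X \<in> \<K>" for X using that by (auto simp: \<K>_def maximal_cliques_def clique_def)
    have zN: "z \<notin> N" using zz by (auto simp: N_def)
    obtain R where R: "tree_on \<K> R" "junction \<K> R"
      using psubset.IH[of "W - {z}"] z(1) by (auto simp: \<K>_def)
    have RV: "R \<subseteq> \<K> \<times> \<K>" using R(1) by (simp add: tree_on_def)
    show ?thesis
    proof (cases "N \<in> \<K>")
      case True
      define f where "f X = (if X = N then ?K else X)" for X
      have inj: "inj_on f \<K>" using zK zN by (auto simp: inj_on_def f_def)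
      have im: "f ` \<K> = insert ?K (\<K> - {N})" using True by (auto simp: f_def)
      have memf: "v \<in> f X \<longleftrightarrow> v \<in> X" if "v \<noteq> z" for v X using that by (auto simp: f_def)
      have zf: "z \<in> f X \<longleftrightarrow> X = N" if "X \<in> \<K>" for X using zK that by (auto simp: f_def)
      have "junction (f ` \<K>) (map_prod f f ` R)"
        unfolding junction_def
      proof (intro allI ballI impI)
        fix v C D assume "C \<in> f ` \<K>" "D \<in> f ` \<K>" and v: "v \<in> C \<inter> D"
        then obtain A B where AB: "A \<in> \<K>" "B \<in> \<K>" "C = f A" "D = f B" by blast
        show "(C, D) \<in> (map_prod f f ` R \<inter> {X. v \<in> X} \<times> {X. v \<in> X})\<^sup>*"
        proof (cases "v = z")
          case True
          then have "C = D" using AB v zf by auto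
          then show ?thesis by simp
        next
          case False
          then have "v \<in> A \<inter> B" using AB v memf by auto
          then have "(A, B) \<in> (R \<inter> {X. v \<in> X} \<times> {X. v \<in> X})\<^sup>*"
            using R(2) AB by (auto simp: junction_def)
          then show ?thesis
            unfolding AB by (rule rtrancl_image) (auto simp: memf[OF False])
        qed
      qed
      then show ?thesis using tree_image[OF R(1) inj] unfolding eq im by blast
    next
      case False
      have "clique (G\<lparr>pverts := W - {z}\<rparr>) N"
        using z zN unfolding clique_update N_def simplicial_def by blast
      then obtain M where M: "M \<in> \<K>" "N \<subseteq> M"
        using clique_in_maximal_clique[of "G\<lparr>pverts := W - {z}\<rparr>" N] psubset.hyps
        by (auto simp: \<K>_def)
      have "?K \<notin> \<K>" using zK by blast
      then have T: "tree_on (insert ?K \<K>) (R \<union> edge M ?K)" by (rule tree_add_leaf[OF R(1) M(1)])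
      have "junction (insert ?K \<K>) (R \<union> edge M ?K)"
        unfolding junction_def
      proof (intro allI ballI impI)
        fix v C D assume CD: "C \<in> insert ?K \<K>" "D \<in> insert ?K \<K>" and v: "v \<in> C \<inter> D"
        let ?P = "(R \<union> edge M ?K) \<inter> {X. v \<in> X} \<times> {X. v \<in> X}"
        have old: "(A, B) \<in> ?P\<^sup>*" if "A \<in> \<K>" "B \<in> \<K>" "v \<in> A \<inter> B" for A B
        proof -
          have "(A, B) \<in> (R \<inter> {X. v \<in> X} \<times> {X. v \<in> X})\<^sup>*"
            using R(2) that by (auto simp: junction_def)
          then show ?thesis by (rule rtrancl_mono[THEN subsetD, rotated]) blast
        qed
        have symP: "sym ?P" using T by (intro sym_Restr) (simp add: tree_on_def)
        have new: "(A, ?K) \<in> ?P\<^sup>*" if "A \<in> \<K>" "v \<in> A \<inter> ?K" for A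
        proof -
          have "v \<in> N" using that zK by auto
          then have "(A, M) \<in> ?P\<^sup>*" "(M, ?K) \<in> ?P" using old[of A M] that M by auto
          then show ?thesis by (rule rtrancl.rtrancl_into_rtrancl)
        qed
        show "(C, D) \<in> ?P\<^sup>*"
          using CD v old[of C D] new[of C] new[of D] sym_rtrancl_swap[OF symP, of ?K D] by blast
      qed
      moreover have "insert ?K (\<K> - {N}) = insert ?K \<K>" using False by simp
      ultimately show ?thesis using T unfolding eq by metis
    qed
  qed
qed

section \<open>Walks, cycles and trees as relations\<close>

lemma connected_with_proj_iff:
  assumes "pair_wf_digraph H" and "sym (parcs H)"
  shows "Digraph_Component.connected (with_proj H) \<longleftrightarrow>
           pverts H \<noteq> {} \<and> (\<forall>u\<in>pverts H. \<forall>v\<in>pverts H. (u, v) \<in> (parcs H)\<^sup>*)"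
proof -
  interpret pair_wf_digraph H by fact
  have "parcs (mk_symmetric (with_proj H)) = parcs H"
    using assms(2) by (auto simp: parcs_mk_symmetric dest: symD)
  then have "mk_symmetric (with_proj H) = H"
    by (intro pair_pre_digraph.equality) auto
  then show ?thesis
    by (simp add: connected_def strongly_connected_def reachable_conv' cong: ball_cong)
qed

text \<open>
  \<open>Q\<close> serves as the arc set of a digraph of its own, so that the path obtained uses arcs of \<open>Q\<close>
  only.
\<close>

lemma apath_in_relation:
  assumes "Q \<subseteq> V \<times> V" and "u \<in> V" and "(u, v) \<in> Q\<^sup>*"
  obtains p where "set p \<subseteq> Q" "pcas u p v" "distinct (pawalk_verts u p)"
proof -
  interpret pair_wf_digraph "\<lparr>pverts = V, parcs = Q\<rparr>"
    using assms(1) by unfold_locales auto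
  obtain p where "apath u p v"
    using assms(2,3) reachable_apath[of u v] by (auto simp: reachable_conv')
  then show thesis using that by (auto simp: apath_def awalk_def)
qed

lemma pawalk_verts_eq: "pcas u p v \<Longrightarrow> pawalk_verts u p = map fst p @ [v]"
  by (induction p arbitrary: u) auto

lemma pcas_in_rtrancl: "pcas u p v \<Longrightarrow> set p \<subseteq> Q \<Longrightarrow> (u, v) \<in> Q\<^sup>*"
  by (induction p arbitrary: u) (auto intro: converse_rtrancl_into_rtrancl)

lemma pcas_append: "pcas u (p @ q) w \<longleftrightarrow> (\<exists>v. pcas u p v \<and> pcas v q w)"
  by (induction p arbitrary: u) auto

lemma undirected_cycle_iff:
  "undirected_cycle H p \<longleftrightarrow>
     (\<exists>u\<in>pverts H. set p \<subseteq> parcs H \<and> pcas u p u \<and> distinct (map fst p) \<and> 3 \<le> length p)"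
proof -
  have "distinct (tl (pawalk_verts u p)) \<longleftrightarrow> distinct (map fst p)" if "pcas u p u" "p \<noteq> []" for u
    using that by (cases p) (force simp: pawalk_verts_eq)+
  then show ?thesis
    unfolding undirected_cycle_def pre_digraph.cycle_def pre_digraph.awalk_def
      cas_with_proj_eq awalk_verts_with_proj_eq with_proj_simps
    by (cases "p = []") auto
qed

text \<open>
  Since the ends lie outside \<open>S\<close>, avoiding \<open>S\<close> in the interior means walking outside \<open>S\<close>
  throughout.
\<close>

lemma avoiding_path_iff:
  assumes "pair_wf_digraph G" and "u \<in> pverts G" and "u \<notin> S" "v \<notin> S"
  shows "(\<exists>p. avoiding_path G S u p v) \<longleftrightarrow> (u, v) \<in> (parcs G \<inter> (- S) \<times> (- S))\<^sup>*"
proof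
  interpret pair_wf_digraph G by fact
  have walk: "(u, v) \<in> (parcs G \<inter> (- S) \<times> (- S))\<^sup>*"
    if "pcas u p v" "set p \<subseteq> parcs G" "set (tl (map fst p)) \<inter> S = {}" "u \<notin> S" for u p
    using that
  proof (induction p arbitrary: u)
    case Nil
    then show ?case by simp
  next
    case (Cons e p)
    have e: "fst e = u" "pcas (snd e) p v" using Cons.prems(1) by auto
    have "snd e \<notin> S \<and> set (tl (map fst p)) \<inter> S = {}"
      using Cons.prems e assms(4) by (cases p) auto
    then have "(snd e, v) \<in> (parcs G \<inter> (- S) \<times> (- S))\<^sup>*"
      "(u, snd e) \<in> parcs G \<inter> (- S) \<times> (- S)"
      using Cons.IH[OF e(2)] Cons.prems e by auto
    then show ?case by (rule converse_rtrancl_into_rtrancl[rotated])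
  qed
  {
    assume "\<exists>p. avoiding_path G S u p v"
    then show "(u, v) \<in> (parcs G \<inter> (- S) \<times> (- S))\<^sup>*"
      using walk assms(3)
      by (auto simp: avoiding_path_def apath_def awalk_def inner_verts_with_proj_def)
  next
    let ?Q = "parcs G \<inter> (- S) \<times> (- S)"
    assume "(u, v) \<in> ?Q\<^sup>*"
    moreover have "?Q \<subseteq> pverts G \<times> pverts G" by (auto dest: wellformed')
    ultimately obtain p where p: "set p \<subseteq> ?Q" "pcas u p v" "distinct (pawalk_verts u p)"
      using assms(2) apath_in_relation by metis
    have "set (tl (map fst p)) \<subseteq> fst ` set p" by (cases p) auto
    moreover have "fst ` set p \<subseteq> - S" using p(1) by force
    ultimately have "set (tl (map fst p)) \<inter> S = {}" by blast
    then have "avoiding_path G S u p v"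
      using p assms(2)
      by (auto simp: avoiding_path_def apath_def awalk_def inner_verts_with_proj_def)
    then show "\<exists>p. avoiding_path G S u p v" by blast
  }
qed

text \<open>
  The rest of a cycle connects the ends of its first edge without that edge; conversely, a path
  that bypasses an edge is closed up by it to a cycle. The first claim rests on the bound 3 for the
  length: the closed walk along an edge and back is a cycle of length 2, even if the edge is a bridge.
\<close>

lemma all_bridges_iff_acyclic:
  assumes "sym (parcs H)" and "parcs H \<subseteq> pverts H \<times> pverts H" and "irrefl (parcs H)"
  shows "all_bridges (parcs H) \<longleftrightarrow> (\<nexists>p. undirected_cycle H p)"
proof (intro iffI notI)
  assume bridges: "all_bridges (parcs H)" and "\<exists>p. undirected_cycle H p"
  then obtain p u where p: "set p \<subseteq> parcs H" "pcas u p u" "distinct (map fst p)" "3 \<le> length p"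
    by (auto simp: undirected_cycle_iff)
  obtain x y q where pq: "p = (x, y) # q" using p(4) by (cases p) auto
  obtain z r where qr: "q = (y, z) # r" using p(2,4) pq by (cases q) auto
  obtain w r' where r: "r = (z, w) # r'" using p(2,4) pq qr by (cases r) auto
  \<comment> \<open>Each vertex starts exactly one arc of \<open>p\<close>: \<open>x\<close> starts \<open>(x, y)\<close>, and \<open>y\<close> starts \<open>(y, z)\<close>, where \<open>z\<close>
    differs from \<open>x\<close> because it starts the third arc.\<close>
  have "(x, y) \<notin> set q" "(y, x) \<notin> set q"
    using p(3) unfolding pq qr r by (force simp: image_iff)+
  then have "set q \<subseteq> parcs H - edge x y" using p(1) pq by auto
  moreover have "pcas y q x" using p(2) pq by auto
  ultimately have "(y, x) \<in> (parcs H - edge x y)\<^sup>*" by (intro pcas_in_rtrancl)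
  then show False
    using bridges p(1) pq sym_rtrancl_swap[OF sym_Diff_edge[OF assms(1)]]
    by (auto simp: all_bridges_def)
next
  assume acyclic: "\<nexists>p. undirected_cycle H p"
  show "all_bridges (parcs H)"
    unfolding all_bridges_def
  proof (intro allI impI notI)
    fix x y assume xy: "(x, y) \<in> parcs H" "(x, y) \<in> (parcs H - edge x y)\<^sup>*"
    have mem: "x \<in> pverts H" "(y, x) \<in> parcs H" "x \<noteq> y"
      using xy assms by (auto dest: symD simp: irrefl_def)
    have "parcs H - edge x y \<subseteq> pverts H \<times> pverts H" using assms(2) by blast
    then obtain p where p: "set p \<subseteq> parcs H - edge x y" "pcas x p y" "distinct (pawalk_verts x p)"
      using apath_in_relation mem(1) xy(2) by metis
    have "2 \<le> length p"
    proof (cases p)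
      case Nil
      then show ?thesis using p(2) mem(3) by simp
    next
      case (Cons e q)
      then show ?thesis using p(1,2) by (cases q; cases e) auto
    qed
    then have "undirected_cycle H (p @ [(y, x)])"
      using p mem unfolding undirected_cycle_iff
      by (intro bexI[of _ x]) (auto simp: pawalk_verts_eq pcas_append)
    then show False using acyclic by blast
  qed
qed

lemma undirected_tree_iff:
  "undirected_tree T \<longleftrightarrow> finite (pverts T) \<and> pverts T \<noteq> {} \<and> tree_on (pverts T) (parcs T)"
proof
  assume T: "undirected_tree T"
  then interpret pair_graph T by (simp add: undirected_tree_def)
  have s: "sym (parcs T)" using pair_sym_arcs by (simp add: symmetric_def)
  have "parcs T \<subseteq> pverts T \<times> pverts T" "irrefl (parcs T)"
    by (auto dest: wellformed' no_loops' simp: irrefl_def)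
  with T s show "finite (pverts T) \<and> pverts T \<noteq> {} \<and> tree_on (pverts T) (parcs T)"
    using pair_finite_verts
    by (simp add: undirected_tree_def connected_with_proj_iff[OF pair_wf_digraph]
      all_bridges_iff_acyclic tree_on_def)
next
  assume T: "finite (pverts T) \<and> pverts T \<noteq> {} \<and> tree_on (pverts T) (parcs T)"
  then have R: "sym (parcs T)" "parcs T \<subseteq> pverts T \<times> pverts T" "all_bridges (parcs T)"
    by (auto simp: tree_on_def)
  then have i: "irrefl (parcs T)" by (auto simp: irrefl_def all_bridges_def)
  have "finite (parcs T)" using R(2) T by (auto intro: finite_subset)
  then have g: "pair_graph T"
    using T R i by unfold_locales (auto simp: symmetric_def irrefl_def)
  then interpret pair_graph T .
  have "\<nexists>p. undirected_cycle T p" using all_bridges_iff_acyclic[OF R(1,2) i] R(3) by blast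
  then show "undirected_tree T"
    using T g
    by (simp add: undirected_tree_def connected_with_proj_iff[OF pair_wf_digraph R(1)] tree_on_def)
qed

section \<open>Clique trees as junction trees\<close>

lemma finite_maximal_cliques: "finite (pverts G) \<Longrightarrow> finite (maximal_cliques G)"
  by (rule finite_subset[of _ "Pow (pverts G)"]) (auto simp: maximal_cliques_def clique_def)

lemma maximal_clique_of_adjacent:
  assumes "pair_graph G" and "(u, v) \<in> parcs G"
  obtains C where "C \<in> maximal_cliques G" "u \<in> C" "v \<in> C"
proof -
  interpret pair_graph G by fact
  have "clique G {u, v}"
    using assms(2) by (auto simp: clique_def intro: arcs_symmetric dest: wellformed')
  from clique_in_maximal_clique[OF pair_finite_verts this]
  obtain C where "C \<in> maximal_cliques G" "{u, v} \<subseteq> C" .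
  then show thesis using that[of C] by simp
qed

lemma maximal_clique_of_vertex:
  assumes "finite (pverts G)" and "v \<in> pverts G"
  obtains C where "C \<in> maximal_cliques G" "v \<in> C"
  using clique_in_maximal_clique[OF assms(1), of "{v}"] assms(2) by (auto simp: clique_def)

text \<open>
  The maximal cliques that contain a given vertex form a nonempty set, which the notion of
  connectedness in \<open>clique_tree\<close> requires.
\<close>

lemma clique_tree_iff:
  assumes "finite (pverts G)" and "pverts G \<noteq> {}"
  shows "clique_tree G T \<longleftrightarrow> pverts T = maximal_cliques G \<and>
           tree_on (maximal_cliques G) (parcs T) \<and> junction (maximal_cliques G) (parcs T)"
proof -
  let ?\<K> = "maximal_cliques G"
  have ne: "?\<K> \<noteq> {}" using maximal_clique_of_vertex[OF assms(1)] assms(2) by blast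
  define P where "P v \<longleftrightarrow> (\<forall>C\<in>?\<K>. \<forall>D\<in>?\<K>. v \<in> C \<inter> D \<longrightarrow>
      (C, D) \<in> (parcs T \<inter> {X. v \<in> X} \<times> {X. v \<in> X})\<^sup>*)" for v
  have "(\<forall>v\<in>pverts G. Digraph_Component.connected (with_proj T \<restriction> {C \<in> ?\<K>. v \<in> C})) \<longleftrightarrow>
        junction ?\<K> (parcs T)"
    if T: "pverts T = ?\<K>" "tree_on ?\<K> (parcs T)"
  proof -
    have conn: "Digraph_Component.connected (with_proj T \<restriction> {C \<in> ?\<K>. v \<in> C}) \<longleftrightarrow> P v"
      if "v \<in> pverts G" for v
    proof -
      let ?S = "{C \<in> ?\<K>. v \<in> C}"
      let ?H = "\<lparr>pverts = ?S, parcs = parcs T \<inter> ?S \<times> ?S\<rparr>"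
      have eq: "with_proj T \<restriction> ?S = with_proj ?H"
        by (auto simp: induce_subgraph_def with_proj_def)
      have P: "parcs T \<inter> ?S \<times> ?S = parcs T \<inter> {X. v \<in> X} \<times> {X. v \<in> X}"
        using T(2) by (auto simp: tree_on_def)
      have "sym (parcs ?H)" using T(2) by (auto intro: sym_Restr simp: tree_on_def)
      moreover have "pair_wf_digraph ?H" by unfold_locales auto
      moreover have "?S \<noteq> {}" using maximal_clique_of_vertex[OF assms(1) that] by blast
      ultimately show ?thesis
        unfolding eq by (subst connected_with_proj_iff) (auto simp: P P_def)
    qed
    have "C \<subseteq> pverts G" if "C \<in> ?\<K>" for C
      using that by (simp add: maximal_cliques_def clique_def)
    then have "P v" if "v \<notin> pverts G" for v using that unfolding P_def by blast
    moreover have "junction ?\<K> (parcs T) \<longleftrightarrow> (\<forall>v. P v)" by (simp add: junction_def P_def)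
    ultimately show ?thesis using conn by blast
  qed
  then show ?thesis
    using ne finite_maximal_cliques[OF assms(1)] unfolding clique_tree_def undirected_tree_iff by auto
qed

section \<open>Chordal graphs have no holes\<close>

text \<open>
  In a path of minimal length, a repeated vertex or a step that skips vertices would permit a
  shorter path.
\<close>

lemma shortest_path:
  assumes "(s, t) \<in> P\<^sup>*"
  obtains n g where "g 0 = s" "g n = t" "\<And>i. i < n \<Longrightarrow> (g i, g (Suc i)) \<in> P" "inj_on g {..n}"
    "\<And>i j. i < j \<Longrightarrow> j \<le> n \<Longrightarrow> (g i, g j) \<in> P \<Longrightarrow> j = Suc i"
proof -
  define n where "n = (LEAST n. (s, t) \<in> P ^^ n)"
  obtain k where "(s, t) \<in> P ^^ k" using assms rtrancl_power by blast
  then have "(s, t) \<in> P ^^ n" unfolding n_def by (rule LeastI)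
  then obtain g where g: "g 0 = s" "g n = t" "\<And>i. i < n \<Longrightarrow> (g i, g (Suc i)) \<in> P"
    by (auto simp: relpow_fun_conv)
  have least: "n \<le> m" if "(s, t) \<in> P ^^ m" for m using that unfolding n_def by (rule Least_le)
  have seg: "(g i, g (i + d)) \<in> P ^^ d" if "i + d \<le> n" for i d
    using that
  proof (induction d)
    case (Suc d)
    then have "(g i, g (i + d)) \<in> P ^^ d" "(g (i + d), g (Suc (i + d))) \<in> P" using g(3) by auto
    then show ?case by auto
  qed simp
  have pre: "(s, g i) \<in> P ^^ i" and suf: "(g i, t) \<in> P ^^ (n - i)" if "i \<le> n" for i
    using that seg[of 0 i] seg[of i "n - i"] g by auto
  have "inj_on g {..n}"
  proof (rule linorder_inj_onI)
    fix i j assume ij: "i < j" "i \<in> {..n}" "j \<in> {..n}"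
    show "g i \<noteq> g j"
    proof
      assume "g i = g j"
      then have "(s, t) \<in> P ^^ i O P ^^ (n - j)" using pre[of i] suf[of j] ij by auto
      then have "(s, t) \<in> P ^^ (i + (n - j))" by (simp add: relpow_add)
      then show False using least ij by fastforce
    qed
  qed auto
  moreover have "j = Suc i" if ij: "i < j" "j \<le> n" "(g i, g j) \<in> P" for i j
  proof -
    have "(s, t) \<in> (P ^^ i O P ^^ 1) O P ^^ (n - j)" using pre[of i] suf[of j] ij by auto
    then have "(s, t) \<in> P ^^ (i + 1 + (n - j))" by (simp only: relpow_add)
    then show ?thesis using least[of "i + 1 + (n - j)"] ij by linarith
  qed
  ultimately show thesis using that g by metis
qed

lemma pcas_upt: "a \<le> b \<Longrightarrow> pcas (f a) (map (\<lambda>i. (f i, f (Suc i))) [a..<b]) (f b)"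
  by (induction b) (auto simp: pcas_append le_Suc_eq)

text \<open>
  A shortest path from \<open>s\<close> to \<open>t\<close> via \<open>B\<close>, closed up through \<open>x\<close>, is a cycle of length at least 4 if
  \<open>s\<close> and \<open>t\<close> are not adjacent. A chord of it would either shorten the path or join \<open>x\<close>
  to an interior vertex of the path, hence to a vertex of \<open>B\<close>.
\<close>

lemma chordal_no_hole:
  assumes "pair_graph G" and "chordal G"
  shows "no_hole (parcs G)"
  unfolding no_hole_def
proof (intro allI impI, rule ccontr)
  interpret pair_graph G by fact
  fix x s t B
  let ?E = "parcs G"
  let ?P = "?E \<inter> (B \<union> {s, t}) \<times> (B \<union> {s, t})"
  assume xs: "(x, s) \<in> ?E" and xt: "(x, t) \<in> ?E" and "s \<noteq> t"
    and B: "\<forall>b\<in>B. b \<noteq> x \<and> (x, b) \<notin> ?E" and st: "(s, t) \<in> ?P\<^sup>*" "(s, t) \<notin> ?E"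
  obtain n g where g: "g 0 = s" "g n = t" "\<And>i. i < n \<Longrightarrow> (g i, g (Suc i)) \<in> ?P"
    and inj: "inj_on g {..n}"
    and short: "\<And>i j. i < j \<Longrightarrow> j \<le> n \<Longrightarrow> (g i, g j) \<in> ?P \<Longrightarrow> j = Suc i"
    using shortest_path[OF st(1)] by metis
  have symE: "(v, u) \<in> ?E" if "(u, v) \<in> ?E" for u v using that by (rule arcs_symmetric)
  have irr: "(u, u) \<notin> ?E" for u using no_loops' by blast
  have "n \<noteq> 0" using g \<open>s \<noteq> t\<close> by (metis)
  moreover have "n \<noteq> 1" using g(1,2) g(3)[of 0] st(2) by auto
  ultimately have n: "2 \<le> n" by simp
  have gB: "g i \<in> B \<union> {s, t}" if "i \<le> n" for i
    using that g(1,2) g(3)[of i] by (cases "i = n") auto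
  have gx: "g i \<noteq> x" if "i \<le> n" for i using gB[OF that] B xs xt irr by auto
  \<comment> \<open>The cycle visits \<open>f 0, \<dots>, f (n + 1)\<close> and is back at \<open>f (n + 2) = f 0\<close>.\<close>
  define f where "f i = (if i \<le> n then g i else if i = Suc n then x else s)" for i
  define p where "p = map (\<lambda>i. (f i, f (Suc i))) [0..<n + 2]"
  have "(f i, f (Suc i)) \<in> ?E" if "i < n + 2" for i
  proof -
    from that consider "i < n" | "i = n" | "i = Suc n" by linarith
    then show ?thesis using g xs symE[OF xt] by cases (auto simp: f_def)
  qed
  then have "set p \<subseteq> ?E" by (auto simp: p_def)
  moreover have "pcas (f 0) p (f 0)"
    using pcas_upt[of 0 "n + 2" f] g(1) by (simp add: p_def f_def)
  moreover have "inj_on f {0..<n + 2}"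
  proof (rule linorder_inj_onI)
    fix i j assume ij: "i < j" "i \<in> {0..<n + 2}" "j \<in> {0..<n + 2}"
    show "f i \<noteq> f j"
    proof (cases "j = Suc n")
      case True
      then show ?thesis using gx[of i] ij by (simp add: f_def)
    next
      case False
      then have "i \<le> n" "j \<le> n" "i \<noteq> j" using ij by auto
      then show ?thesis using inj_onD[OF inj, of i j] by (auto simp: f_def)
    qed
  qed auto
  then have "distinct (map fst p)"
    unfolding p_def map_map o_def fst_conv distinct_map set_upt by simp
  moreover have "f 0 \<in> pverts G" using xs g(1) by (auto simp: f_def dest: wellformed')
  moreover have len: "4 \<le> length p" using n by (simp add: p_def)
  ultimately have "undirected_cycle G p" unfolding undirected_cycle_iff by auto
  then obtain u v where uv: "chord G p u v" using assms(2) len by (auto simp: chordal_def)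
  have setp: "set p = (\<lambda>i. (f i, f (Suc i))) ` {..<n + 2}"
    unfolding p_def set_map set_upt atLeast0LessThan by simp
  obtain i j where ij: "i < n + 2" "j < n + 2" "u = f i" "v = f j"
    using uv unfolding chord_def setp by auto
  have nop: "(f k, f (Suc k)) \<noteq> (f i, f j)" "(f k, f (Suc k)) \<noteq> (f j, f i)" if "k < n + 2" for k
  proof -
    have "(f k, f (Suc k)) \<in> set p" unfolding setp using that by blast
    moreover have "(u, v) \<notin> set p" "(v, u) \<notin> set p" using uv by (auto simp: chord_def)
    ultimately show "(f k, f (Suc k)) \<noteq> (f i, f j)" "(f k, f (Suc k)) \<noteq> (f j, f i)"
      using ij by metis+
  qed
  have E: "(f i, f j) \<in> ?E" "(f j, f i) \<in> ?E" using uv ij symE by (auto simp: chord_def)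
  have no_chord: False
    if a: "a < b" "b < n + 2" "(f a, f b) \<in> ?E"
      and na: "\<And>k. k < n + 2 \<Longrightarrow> (f k, f (Suc k)) \<noteq> (f a, f b)"
        "\<And>k. k < n + 2 \<Longrightarrow> (f k, f (Suc k)) \<noteq> (f b, f a)" for a b
  proof (cases "b \<le> n")
    case True
    then have "(g a, g b) \<in> ?P" using a gB[of a] gB[of b] by (auto simp: f_def)
    then have "b = Suc a" using short a(1) True by blast
    then show False using na(1)[of a] a by auto
  next
    case False
    then have b: "b = Suc n" "a \<le> n" using a by auto
    then have "(x, g a) \<in> ?E" using a(3) symE by (auto simp: f_def)
    then have "g a \<in> {s, t}" using gB[OF b(2)] B by blast
    then have "a = 0 \<or> a = n"
      using inj g(1,2) b(2) by (auto simp: inj_on_def)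
    then show False
      using na(1)[of n] na(2)[of "Suc n"] b g by (auto simp: f_def)
  qed
  show False
    using no_chord[of i j] no_chord[of j i] ij E nop irr by (metis linorder_neqE_nat)
qed

section \<open>Junction trees and the reduced clique graph\<close>

text \<open>
  Following a walk outside \<open>C \<inter> D\<close>, all cliques met by it stay on the side of \<open>C\<close> when the
  edge \<open>CD\<close> is removed: cliques sharing a vertex outside \<open>C \<inter> D\<close> lie on the same side, and
  successive vertices of the walk share a clique.
\<close>

lemma junction_tree_edge_separates:
  assumes "pair_graph G" and "sym R" and J: "junction (maximal_cliques G) R"
    and "C \<in> maximal_cliques G" "u \<in> C"
    and "(u, v) \<in> (parcs G \<inter> (- (C \<inter> D)) \<times> (- (C \<inter> D)))\<^sup>*" and "u \<notin> C \<inter> D"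
    and "X \<in> maximal_cliques G" "v \<in> X"
  shows "(C, X) \<in> (R - edge C D)\<^sup>*"
proof -
  let ?Q = "(R - edge C D)\<^sup>*"
  have same: "(X, Y) \<in> ?Q"
    if "X \<in> maximal_cliques G" "Y \<in> maximal_cliques G" "w \<in> X" "w \<in> Y" "w \<notin> C \<inter> D" for X Y w
    using junction_separating_edge[OF J that(1,2), of C D] that(3-5) by blast
  show ?thesis
    using assms(6,8,9)
  proof (induction arbitrary: X rule: rtrancl_induct)
    case base
    then show ?case using same assms(4,5,7) by blast
  next
    case (step v w)
    then obtain Z where Z: "Z \<in> maximal_cliques G" "v \<in> Z" "w \<in> Z"
      using maximal_clique_of_adjacent[OF assms(1)] by blast
    then have "(C, Z) \<in> ?Q" by (intro step.IH)
    moreover have "(Z, X) \<in> ?Q" using same[of Z X w] Z step by blast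
    ultimately show ?case by (rule rtrancl_trans)
  qed
qed

lemma maximal_cliques_not_subset:
  "C \<in> maximal_cliques G \<Longrightarrow> D \<in> maximal_cliques G \<Longrightarrow> C \<noteq> D \<Longrightarrow> \<exists>u. u \<in> C - D"
  by (auto simp: maximal_cliques_def)

text \<open>
  The ends of \<open>CD\<close> are disconnected when \<open>CD\<close> is removed, so by \<open>junction_tree_edge_separates\<close> no
  walk outside \<open>C \<inter> D\<close> leads from \<open>C - D\<close> to \<open>D - C\<close>. If \<open>C \<inter> D\<close> were empty, this would contradict
  the connectedness of \<open>G\<close>.
\<close>

lemma junction_tree_subset_reduced_clique_graph:
  assumes "pair_graph G" and conn: "\<And>u v. u \<in> pverts G \<Longrightarrow> v \<in> pverts G \<Longrightarrow> (u, v) \<in> (parcs G)\<^sup>*"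
    and T: "tree_on (maximal_cliques G) R" and J: "junction (maximal_cliques G) R"
  shows "R \<subseteq> parcs (reduced_clique_graph G)"
proof (rule subrelI)
  interpret pair_graph G by fact
  fix C D assume CD: "(C, D) \<in> R"
  have R: "sym R" "(C, D) \<notin> (R - edge C D)\<^sup>*" using T CD by (auto simp: tree_on_def all_bridges_def)
  have mem: "C \<in> maximal_cliques G" "D \<in> maximal_cliques G" "C \<noteq> D"
    using T CD R by (auto simp: tree_on_def)
  have verts: "C \<subseteq> pverts G" "D \<subseteq> pverts G"
    using mem by (auto simp: maximal_cliques_def clique_def)
  have sep: "(u, v) \<notin> (parcs G \<inter> (- (C \<inter> D)) \<times> (- (C \<inter> D)))\<^sup>*"
    if "u \<in> C - D" "v \<in> D - C" for u v
    using junction_tree_edge_separates[OF assms(1) R(1) J mem(1) _ _ _ mem(2)] that R(2) by blast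
  then have "separating_pair G C D"
    unfolding separating_pair_def using verts avoiding_path_iff[OF pair_wf_digraph] by blast
  moreover have "C \<inter> D \<noteq> {}"
  proof
    assume e: "C \<inter> D = {}"
    obtain u v where "u \<in> C - D" "v \<in> D - C"
      using maximal_cliques_not_subset mem by metis
    then show False using sep[of u v] conn[of u v] verts by (auto simp: e)
  qed
  ultimately show "(C, D) \<in> parcs (reduced_clique_graph G)"
    using mem by (simp add: reduced_clique_graph_def)
qed

text \<open>
  If every edge on the tree path from \<open>C\<close> to \<open>D\<close> had a vertex of its intersection outside
  \<open>S = C \<inter> D\<close>, these vertices would form a walk outside \<open>S\<close> from \<open>C - D\<close> to \<open>D - C\<close>, as successive
  ones share a clique. So some edge satisfies \<open>X \<inter> Y \<subseteq> S\<close>, and the reverse inclusion holds for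
  every edge on that path.
\<close>

lemma separating_pair_tight_edge:
  assumes "pair_graph G" and T: "tree_on (maximal_cliques G) R" and J: "junction (maximal_cliques G) R"
    and mem: "C \<in> maximal_cliques G" "D \<in> maximal_cliques G" "C \<noteq> D" and sep: "separating_pair G C D"
  obtains X Y where "(X, Y) \<in> R" "(C, D) \<notin> (R - edge X Y)\<^sup>*" "X \<inter> Y = C \<inter> D"
proof -
  interpret pair_graph G by fact
  \<comment> \<open>A defined constant, so that the induction along the path does not generalize \<open>D\<close> inside it.\<close>
  define S where "S = C \<inter> D"
  define F where "F = {(X, Y) \<in> R. X \<inter> Y \<subseteq> S}"
  let ?E = "parcs G \<inter> (- S) \<times> (- S)"
  have R: "sym R" "all_bridges R" "(C, D) \<in> R\<^sup>*" using T mem by (auto simp: tree_on_def)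
  have "finite R"
    using T finite_maximal_cliques[OF pair_finite_verts]
    by (auto simp: tree_on_def intro: finite_subset[OF _ finite_cartesian_product])
  then have F: "finite F" "F \<subseteq> R" by (auto simp: F_def intro: finite_subset)
  have clique: "(u, v) \<in> parcs G" if "X \<in> maximal_cliques G" "u \<in> X" "v \<in> X" "u \<noteq> v" for X u v
    using that by (auto simp: maximal_cliques_def clique_def)
  have verts: "C \<subseteq> pverts G" using mem by (auto simp: maximal_cliques_def clique_def)
  have "\<exists>X Y. (X, Y) \<in> F \<and> (C, D) \<notin> (R - edge X Y)\<^sup>*"
  proof (rule ccontr)
    assume "\<not> ?thesis"
    then have "(C, D) \<in> (R - (F \<union> F\<inverse>))\<^sup>*"
      using rtrancl_remove_edges[OF R(1,2) F R(3)] by blast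
    then have "\<exists>u\<in>C - S. \<exists>v\<in>D - S. (u, v) \<in> ?E\<^sup>*"
    proof (induction rule: rtrancl_induct)
      case base
      obtain u where "u \<in> C - S" using maximal_cliques_not_subset[OF mem] unfolding S_def by blast
      then show ?case by blast
    next
      case (step X Y)
      then obtain u v where uv: "u \<in> C - S" "v \<in> X - S" "(u, v) \<in> ?E\<^sup>*" by blast
      obtain w where w: "w \<in> X" "w \<in> Y" "w \<notin> S" using step.hyps(2) by (auto simp: F_def)
      have "X \<in> maximal_cliques G" using step.hyps(2) T by (auto simp: tree_on_def)
      then have "(v, w) \<in> ?E\<^sup>*" using clique[of X v w] uv(2) w by (cases "v = w") auto
      then show ?case using uv w by (meson DiffI rtrancl_trans)
    qed
    then obtain u v where "u \<in> C - D" "v \<in> D - C" "(u, v) \<in> ?E\<^sup>*" unfolding S_def by blast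
    then show False
      using sep avoiding_path_iff[OF pair_wf_digraph, of u S v] verts
      unfolding separating_pair_def S_def by blast
  qed
  then obtain X Y where XY: "(X, Y) \<in> F" "(C, D) \<notin> (R - edge X Y)\<^sup>*" by blast
  moreover have "S \<subseteq> X \<inter> Y" using junction_separating_edge[OF J mem(1,2) XY(2)] by (simp add: S_def)
  ultimately have "X \<inter> Y = C \<inter> D" "(X, Y) \<in> R" by (auto simp: F_def S_def)
  then show thesis using that XY(2) by blast
qed

theorem theorem2p2:
  fixes G :: "'a pair_pre_digraph" and \<sigma> :: "'a set \<Rightarrow> nat"
  assumes "pair_graph G"
    and "Digraph_Component.connected (with_proj G)"
    and "chordal G"
    and "legitimate_weighting G \<sigma>"
  shows "(\<forall>T. clique_tree G T \<longrightarrow> undirected_spanning_tree T (reduced_clique_graph G)) \<and>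
         (\<forall>e \<in> edges (reduced_clique_graph G). \<exists>T. clique_tree G T \<and> e \<in> edges T) \<and>
         (\<forall>T. undirected_spanning_tree T (reduced_clique_graph G) \<longrightarrow>
            (clique_tree G T \<longleftrightarrow>
               (\<forall>T'. undirected_spanning_tree T' (reduced_clique_graph G) \<longrightarrow>
                  tree_weight \<sigma> T' \<le> tree_weight \<sigma> T)))"
proof -
  interpret pair_graph G by fact
  let ?\<K> = "maximal_cliques G" and ?CR = "reduced_clique_graph G"
  have symE: "sym (parcs G)" using pair_sym_arcs by (simp add: symmetric_def)
  have conn: "pverts G \<noteq> {}" "\<And>u v. u \<in> pverts G \<Longrightarrow> v \<in> pverts G \<Longrightarrow> (u, v) \<in> (parcs G)\<^sup>*"
    using assms(2) connected_with_proj_iff[OF pair_wf_digraph symE] by auto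
  have fin: "finite ?\<K>" by (rule finite_maximal_cliques[OF pair_finite_verts])
  have ne: "?\<K> \<noteq> {}" using maximal_clique_of_vertex[OF pair_finite_verts] conn(1) by blast
  note ct = clique_tree_iff[OF pair_finite_verts conn(1)]
  interpret CR: pair_graph ?CR by (rule pair_graph_reduced_clique_graph) fact
  have CR_verts: "pverts ?CR = ?\<K>" by (simp add: reduced_clique_graph_def)
  have st: "undirected_spanning_tree T ?CR \<longleftrightarrow>
      pverts T = ?\<K> \<and> tree_on ?\<K> (parcs T) \<and> parcs T \<subseteq> parcs ?CR" for T
  proof -
    have "pair_wf_digraph T" if "pverts T = ?\<K>" "tree_on ?\<K> (parcs T)"
      using that by unfold_locales (auto simp: tree_on_def)
    then show ?thesis
      using ne fin CR.pair_wf_digraph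
      by (auto simp: undirected_spanning_tree_def undirected_tree_iff spanning_def subgraph_def
        CR_verts wf_digraph_wp_iff)
  qed
  have spanning: "undirected_spanning_tree T ?CR" if "clique_tree G T" for T
    using that junction_tree_subset_reduced_clique_graph[OF assms(1) conn(2)] by (simp add: ct st)
  have w: "tree_weight \<sigma> T = weight \<sigma> (parcs T)" for T
    by (simp add: tree_weight_def weight_def edges_def)
  have "irrefl (parcs G)" using no_loops' by (auto simp: irrefl_def)
  from junction_tree_exists[OF symE this chordal_no_hole[OF assms(1,3)] pair_finite_verts]
  obtain R where R: "tree_on ?\<K> R" "junction ?\<K> R" by auto
  have edge_in_clique_tree: "\<exists>T. clique_tree G T \<and> e \<in> edges T" if "e \<in> edges ?CR" for e
  proof -
    from that obtain C D where e: "e = {C, D}" "(C, D) \<in> parcs ?CR" by (auto simp: edges_def)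
    then have CD: "C \<in> ?\<K>" "D \<in> ?\<K>" "C \<noteq> D" "separating_pair G C D"
      by (auto simp: reduced_clique_graph_def)
    obtain X Y where XY: "(X, Y) \<in> R" "(C, D) \<notin> (R - edge X Y)\<^sup>*" "X \<inter> Y = C \<inter> D"
      using separating_pair_tight_edge[OF assms(1) R CD] by metis
    let ?T = "\<lparr>pverts = ?\<K>, parcs = R - edge X Y \<union> edge C D\<rparr>"
    have "sym R" using R(1) by (simp add: tree_on_def)
    then have "clique_tree G ?T"
      using tree_swap_edge[OF R(1) XY(1) CD(1,2) XY(2)]
        junction_swap_edge[OF _ R(2) CD(1,2) XY(2,3)] by (simp add: ct)
    moreover have "e \<in> edges ?T" by (auto simp: e edges_def)
    ultimately show ?thesis by blast
  qed
  have mono: "\<sigma> (A \<inter> B) < \<sigma> (C \<inter> D)"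
    if "A \<in> ?\<K>" "B \<in> ?\<K>" "C \<in> ?\<K>" "D \<in> ?\<K>" "A \<noteq> B" "C \<noteq> D" "A \<inter> B \<subset> C \<inter> D" for A B C D
    using assms(4) that unfolding legitimate_weighting_def weighting_domain_def by blast
  note max = junction_tree_max_weight[where \<sigma> = \<sigma>, OF fin mono]
  have "clique_tree G T \<longleftrightarrow>
      (\<forall>T'. undirected_spanning_tree T' ?CR \<longrightarrow> tree_weight \<sigma> T' \<le> tree_weight \<sigma> T)"
    if T: "undirected_spanning_tree T ?CR" for T
  proof
    assume "clique_tree G T"
    then show "\<forall>T'. undirected_spanning_tree T' ?CR \<longrightarrow> tree_weight \<sigma> T' \<le> tree_weight \<sigma> T"
      using max[of "parcs T"] by (simp add: ct st w)
  next
    assume T_max: "\<forall>T'. undirected_spanning_tree T' ?CR \<longrightarrow> tree_weight \<sigma> T' \<le> tree_weight \<sigma> T"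
    have "undirected_spanning_tree \<lparr>pverts = ?\<K>, parcs = R\<rparr> ?CR"
      using R by (intro spanning) (simp add: ct)
    then have "weight \<sigma> R \<le> weight \<sigma> (parcs T)" using T_max by (force simp: w)
    then have "junction ?\<K> (parcs T)"
      using max[OF _ _ _ _ _ _ _ R, of "parcs T"] T by (force simp: st)
    then show "clique_tree G T" using T by (simp add: ct st)
  qed
  then show ?thesis using spanning edge_in_clique_tree by blast
qed

end
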